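(* Let $B=F(b_1,\ldots,b_n)$ be a Ferrers board with $0\le b_1\le\cdots\le b_n$ and $b_n>0$, and let $x$ be an integer with $x\ge b_n$. Then $$[x]_q^n=\sum_{k=0}^n\mathbf{RT}_{n-k}(B,q)\,[x-F_{b_1}]_q[x-F_{b_2}]_q\cdots[x-F_{b_k}]_q.$$
   Context: Fibonacci numbers: $F_0=0$, $F_1=1$, $F_m=F_{m-1}+F_{m-2}$. For any integer $m$, $[m]_q=\frac{1-q^m}{1-q}$ (a rational function of $q$; $[0]_q=0$). For $m\ge1$, $\mathcal{F}_m$ is the set of tilings of a column of height $m$ (levels $1,\dots,m$ from the bottom) by tiles of heights 1 and 2 whose bottom-most tile has height 1; $\mathcal{F}_0=\emptyset$. For $T\in\mathcal{F}_m$, $\mathrm{rank}_m(T)=\sum F_{i-1}$, the sum over all $i$ such that $T$ has a tile of height 2 occupying levels $i-1$ and $i$. A Ferrers board $F(b_1,\dots,b_n)$ has columns $1,\dots,n$ of heights $b_1\le\cdots\le b_n$. For $0\le k\le n$, $\mathcal{NT}_k(B)$ is the set of Fibonacci rook placements with $k$ tilings: a sequence of columns $1\le i_1<\cdots<i_k\le n$ together with, for each $s=1,\dots,k$, a tiling $T_{i_s}\in\mathcal{F}_{e_s}$ where $e_s=b_{i_s-s+1}$ (geometrically, each tiling cancels top cells of the columns to its right so that after $s$ tilings the untiled columns have $b_1,\dots,b_{n-s}$ uncanceled cells from left to right). For $k=0$ only the empty placement exists. For such $P$, $W_{B,q}(P)=q^{\sum_{s=1}^k\mathrm{rank}_{e_s}(T_{i_s})+\sum_{t=1}^{n-k}F_{b_t}}$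 and $\mathbf{RT}_k(B,q)=\sum_{P\in\mathcal{NT}_k(B)}W_{B,q}(P)$. An empty product equals 1. *)

theory Defs
  imports
    "HOL-Number_Theory.Fib"
    "HOL-Computational_Algebra.Polynomial"
    "HOL-Computational_Algebra.Fraction_Field"
begin

text \<open>Identities in \<open>q\<close> are identities in the field \<open>\<rat>(q)\<close> of rational functions.\<close>

definition q_var :: "rat poly fract" where
  "q_var = Fract [:0, 1:] 1"

definition q_int :: "int \<Rightarrow> rat poly fract" where
  "q_int m = (1 - q_var powi m) / (1 - q_var)"

text \<open>
  A tiling of a column is the list of the heights of its tiles from bottom to top.
  For \<open>m = 0\<close> the conditions \<open>T \<noteq> []\<close> and \<open>sum_list T = 0\<close> are contradictory, so there
  is no tiling of height 0.
\<close>

definition fib_tilings :: "nat \<Rightarrow> nat list set" where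
  "fib_tilings m = {T. set T \<subseteq> {1, 2} \<and> sum_list T = m \<and> T \<noteq> [] \<and> hd T = 1}"

definition tile_levels :: "nat list \<Rightarrow> nat \<Rightarrow> nat set" where
  "tile_levels T j = {sum_list (take j T) + 1 .. sum_list (take (Suc j) T)}"

definition tiling_rank :: "nat list \<Rightarrow> nat" where
  "tiling_rank T =
     (\<Sum>i | \<exists>j<length T. T ! j = 2 \<and> tile_levels T j = {i - 1, i}. fib (i - 1))"

definition ferrers_board :: "nat \<Rightarrow> (nat \<Rightarrow> nat) \<Rightarrow> bool" where
  "ferrers_board n b \<longleftrightarrow> (\<forall>i j. 1 \<le> i \<and> i \<le> j \<and> j \<le> n \<longrightarrow> b i \<le> b j)"

text \<open>
  A placement is the list of pairs \<open>(i\<^sub>s, T\<^sub>s)\<close> of tiled columns and their tilings. The index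
  \<open>s\<close> in the next three definitions counts from 1.
\<close>

definition column_of :: "(nat \<times> nat list) list \<Rightarrow> nat \<Rightarrow> nat" where
  "column_of P s = fst (P ! (s - 1))"

definition tiling_of :: "(nat \<times> nat list) list \<Rightarrow> nat \<Rightarrow> nat list" where
  "tiling_of P s = snd (P ! (s - 1))"

text \<open>
  The number of uncancelled cells in the \<open>s\<close>-th tiled column. The subtraction does not
  truncate, since \<open>i\<^sub>s \<ge> s\<close> in every placement.
\<close>

definition uncancelled :: "(nat \<Rightarrow> nat) \<Rightarrow> (nat \<times> nat list) list \<Rightarrow> nat \<Rightarrow> nat" where
  "uncancelled b P s = b (column_of P s - s + 1)"

definition placements :: "nat \<Rightarrow> (nat \<Rightarrow> nat) \<Rightarrow> nat \<Rightarrow> (nat \<times> nat list) list set" where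
  "placements n b k =
     {P. length P = k \<and> sorted_wrt (<) (map fst P) \<and> set (map fst P) \<subseteq> {1..n} \<and>
         (\<forall>s\<in>{1..k}. tiling_of P s \<in> fib_tilings (uncancelled b P s))}"

definition placement_weight ::
    "nat \<Rightarrow> (nat \<Rightarrow> nat) \<Rightarrow> (nat \<times> nat list) list \<Rightarrow> rat poly fract" where
  "placement_weight n b P =
     q_var ^ ((\<Sum>s=1..length P. tiling_rank (tiling_of P s)) + (\<Sum>t=1..n - length P. fib (b t)))"

definition RT :: "nat \<Rightarrow> (nat \<Rightarrow> nat) \<Rightarrow> nat \<Rightarrow> rat poly fract" where
  "RT n b k = (\<Sum>P\<in>placements n b k. placement_weight n b P)"

lemma finite_fib_tilings: "finite (fib_tilings m)"
proof -
  have len: "set T \<subseteq> {1, 2} \<Longrightarrow> length T \<le> sum_list T" for T :: "nat list"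
    by (induction T) auto
  have "fib_tilings m \<subseteq> {T. set T \<subseteq> {1, 2} \<and> length T \<le> m}"
    using len by (auto simp: fib_tilings_def)
  then show ?thesis
    using finite_lists_length_le[of "{1, 2 :: nat}" m] finite_subset by auto
qed

lemma finite_placements: "finite (placements n b k)"
proof -
  let ?C = "{1..n} \<times> (\<Union>j\<le>n + 1. fib_tilings (b j))"
  have "placements n b k \<subseteq> {P. set P \<subseteq> ?C \<and> length P = k}"
  proof
    fix P assume P: "P \<in> placements n b k"
    have "P ! s \<in> ?C" if s: "s < length P" for s
    proof -
      have col: "fst (P ! s) \<in> {1..n}"
        using P nth_mem[OF s] by (force simp: placements_def)
      have "tiling_of P (Suc s) \<in> fib_tilings (uncancelled b P (Suc s))"
        using P s by (auto simp: placements_def)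
      then have "snd (P ! s) \<in> fib_tilings (b (fst (P ! s) - Suc s + 1))"
        by (simp add: tiling_of_def uncancelled_def column_of_def)
      moreover have "fst (P ! s) - Suc s + 1 \<le> n + 1"
        using col by auto
      ultimately show ?thesis
        using col by (cases "P ! s") auto
    qed
    then have "set P \<subseteq> ?C"
      by (metis in_set_conv_nth subsetI)
    then show "P \<in> {P. set P \<subseteq> ?C \<and> length P = k}"
      using P by (simp add: placements_def)
  qed
  moreover have "finite ?C"
    using finite_fib_tilings by auto
  ultimately show ?thesis
    using finite_lists_length_eq finite_subset by blast
qed

end

theory Submission
  imports Defs
begin

text \<open>
  By the recurrence \<open>F\<^bsub>m+2\<^esub> = F\<^bsub>m+1\<^esub> + F\<^bsub>m\<^esub>\<close>, applied to the top tile, the rank is a bijection from the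
  tilings of height \<open>m\<close> onto \<open>{0, \<dots>, F\<^bsub>m\<^esub> - 1}\<close>, so that a tiled column of height \<open>m\<close> contributes
  \<open>[F\<^bsub>m\<^esub>]\<^sub>q\<close> to \<open>RT\<close>. Distinguishing whether the last column is tiled therefore gives a two-term
  recurrence for \<open>RT\<close>, in which an untiled column contributes \<open>q\<close> to the power \<open>F\<^bsub>m\<^esub>\<close>. It is the same
  recurrence that expands \<open>[x]\<^sub>q\<^sup>n\<close> in the products \<open>[x - F\<^bsub>b 1\<^esub>]\<^sub>q \<cdots> [x - F\<^bsub>b k\<^esub>]\<^sub>q\<close>, because
  \<open>[x]\<^sub>q = [c]\<^sub>q + q\<^sup>c [x - c]\<^sub>q\<close>.
\<close>

text \<open>
  For \<open>p j = z - j\<close>, \<open>c j = j\<close> and \<open>d j = 1\<close> the coefficients \<open>S\<close> are the Stirling numbers of the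
  second kind.
\<close>

lemma power_eq_sum_prod_of_recurrence:
  fixes z :: "'a::comm_semiring_1" and c d p :: "nat \<Rightarrow> 'a" and S :: "nat \<Rightarrow> nat \<Rightarrow> 'a"
  assumes split: "\<And>j. z = c j + d j * p j"
    and S_0_0: "S 0 0 = 1"
    and S_Suc_0: "\<And>n. S (Suc n) 0 = c 0 * S n 0"
    and S_Suc_Suc: "\<And>n j. j < n \<Longrightarrow> S (Suc n) (Suc j) = d j * S n j + c (Suc j) * S n (Suc j)"
    and S_Suc_diag: "\<And>n. S (Suc n) (Suc n) = d n * S n n"
  shows "z ^ n = (\<Sum>j\<le>n. S n j * (\<Prod>i<j. p i))"
proof (induction n)
  case 0
  show ?case by (simp add: S_0_0)
next
  case (Suc n)
  let ?P = "\<lambda>j. \<Prod>i<j. p i"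
  have P_Suc: "z * ?P j = c j * ?P j + d j * ?P (Suc j)" for j
    by (subst split[of j]) (simp add: algebra_simps)
  have "z ^ Suc n = (\<Sum>j\<le>n. S n j * (z * ?P j))"
    by (simp add: Suc sum_distrib_left mult.left_commute)
  also have "\<dots> = (\<Sum>j\<le>n. c j * S n j * ?P j) + (\<Sum>j\<le>n. d j * S n j * ?P (Suc j))"
    unfolding P_Suc by (simp only: sum.distrib[symmetric] algebra_simps)
  also have "(\<Sum>j\<le>n. c j * S n j * ?P j) =
      S (Suc n) 0 * ?P 0 + (\<Sum>j<n. c (Suc j) * S n (Suc j) * ?P (Suc j))"
    by (simp only: sum.atMost_shift S_Suc_0)
  also have "(\<Sum>j\<le>n. d j * S n j * ?P (Suc j)) =
      (\<Sum>j<n. d j * S n j * ?P (Suc j)) + S (Suc n) (Suc n) * ?P (Suc n)"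
    by (simp only: lessThan_Suc_atMost[symmetric] sum.lessThan_Suc S_Suc_diag)
  also have "S (Suc n) 0 * ?P 0 + (\<Sum>j<n. c (Suc j) * S n (Suc j) * ?P (Suc j)) +
      ((\<Sum>j<n. d j * S n j * ?P (Suc j)) + S (Suc n) (Suc n) * ?P (Suc n)) =
      S (Suc n) 0 * ?P 0 + (\<Sum>j<n. S (Suc n) (Suc j) * ?P (Suc j)) +
      S (Suc n) (Suc n) * ?P (Suc n)"
    by (simp add: S_Suc_Suc sum.distrib distrib_right add_ac)
  also have "\<dots> = (\<Sum>j\<le>Suc n. S (Suc n) j * ?P j)"
    by (simp only: sum.atMost_shift sum.lessThan_Suc add.assoc)
  finally show ?case .
qed

lemma q_var_nonzero: "q_var \<noteq> 0"
  by (simp add: q_var_def Zero_fract_def eq_fract)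

lemma q_var_neq_one: "q_var \<noteq> 1"
  by (simp add: q_var_def One_fract_def eq_fract one_pCons)

lemma q_int_of_nat: "q_int (int n) = (\<Sum>i<n. q_var ^ i)"
  unfolding q_int_def geometric_sum[OF q_var_neq_one]
  using minus_divide_divide[of "q_var ^ n - 1" "q_var - 1"] by simp

lemma q_int_add: "q_int (x + y) = q_int x + q_var powi x * q_int y"
proof -
  have "1 - q_var \<noteq> 0"
    using q_var_neq_one by simp
  then show ?thesis
    by (simp add: q_int_def power_int_add q_var_nonzero field_simps)
qed

lemma fib_tilings_0: "fib_tilings 0 = {}"
proof -
  have "sum_list T \<noteq> 0" if "T \<noteq> []" "hd T = 1" for T :: "nat list"
    using that by (cases T) auto
  then show ?thesis
    by (auto simp: fib_tilings_def)
qed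

lemma fib_tilings_1: "fib_tilings (Suc 0) = {[1]}"
proof -
  have "T = [1]" if "set T \<subseteq> {1, 2}" "sum_list T = Suc 0" "T \<noteq> []" "hd T = 1" for T :: "nat list"
  proof (cases T)
    case (Cons t U)
    then show ?thesis
      using that by (cases U) auto
  qed (use that in simp)
  then show ?thesis
    by (auto simp: fib_tilings_def)
qed

lemma fib_tilings_Suc_Suc:
  "fib_tilings (Suc (Suc m)) =
     (\<lambda>T. T @ [1]) ` fib_tilings (Suc m) \<union> (\<lambda>T. T @ [2]) ` fib_tilings m" (is "_ = ?R")
proof (intro equalityI subsetI)
  fix T assume T: "T \<in> fib_tilings (Suc (Suc m))"
  then obtain U t where U: "T = U @ [t]"
    by (auto simp: fib_tilings_def intro: rev_exhaust)
  with T have "U \<noteq> []"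
    by (auto simp: fib_tilings_def)
  with T U have "U \<in> fib_tilings (Suc m) \<and> t = 1 \<or> U \<in> fib_tilings m \<and> t = 2"
    by (auto simp: fib_tilings_def)
  with U show "T \<in> ?R"
    by auto
qed (auto simp: fib_tilings_def)

lemma tile_levels_domino:
  assumes "j < length T" "T ! j = 2"
  shows "tile_levels T j = {sum_list (take j T) + 1, sum_list (take j T) + 2}"
  using assms by (auto simp: tile_levels_def take_Suc_conv_app_nth)

lemma sum_list_take_less:
  fixes T :: "nat list"
  assumes "j < k" "j < length T" "0 < T ! j"
  shows "sum_list (take j T) < sum_list (take k T)"
proof -
  obtain l where "k = Suc j + l"
    using assms(1) less_iff_Suc_add by auto
  then have "take k T = take j T @ [T ! j] @ take l (drop (Suc j) T)"
    using assms(2) by (simp only: take_add take_Suc_conv_app_nth append_assoc)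
  then show ?thesis
    using assms(3) by simp
qed

lemma tiling_rank_eq_sum:
  "tiling_rank T = (\<Sum>j<length T. if T ! j = 2 then fib (sum_list (take j T) + 1) else 0)"
proof -
  let ?dominoes = "{j \<in> {..<length T}. T ! j = 2}"
  let ?top = "\<lambda>j. sum_list (take j T) + 2"
  have "tile_levels T j = {i - 1, i} \<longleftrightarrow> i = ?top j" if "j < length T" "T ! j = 2" for i j
    unfolding tile_levels_domino[OF that] doubleton_eq_iff by arith
  then have tops: "{i. \<exists>j<length T. T ! j = 2 \<and> tile_levels T j = {i - 1, i}} = ?top ` ?dominoes"
    by blast
  have "inj_on ?top ?dominoes"
  proof (rule linorder_inj_onI)
    fix j k assume "j < k" "j \<in> ?dominoes"
    then show "?top j \<noteq> ?top k"
      using sum_list_take_less[of j k T] by simp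
  qed auto
  then have "tiling_rank T = (\<Sum>j\<in>?dominoes. fib (sum_list (take j T) + 1))"
    unfolding tiling_rank_def tops by (simp add: sum.reindex)
  then show ?thesis
    by (simp only: sum.inter_filter finite_lessThan)
qed

lemma tiling_rank_snoc:
  "tiling_rank (T @ [t]) = tiling_rank T + (if t = 2 then fib (sum_list T + 1) else 0)"
  by (simp add: tiling_rank_eq_sum nth_append cong: if_cong)

lemma bij_betw_tiling_rank_snoc:
  assumes bij: "bij_betw tiling_rank (fib_tilings m) {..<k}"
  defines "c \<equiv> \<lambda>t. if t = 2 then fib (Suc m) else 0"
  shows "bij_betw tiling_rank ((\<lambda>T. T @ [t]) ` fib_tilings m) {c t..<c t + k}"
proof -
  have "bij_betw ((+) (c t)) {..<k} {c t..<c t + k}"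
    by (simp add: bij_betw_def lessThan_atLeast0 add.commute)
  then have "bij_betw ((+) (c t) \<circ> tiling_rank) (fib_tilings m) {c t..<c t + k}"
    by (rule bij_betw_trans[OF bij])
  moreover have "((+) (c t) \<circ> tiling_rank) T = (tiling_rank \<circ> (\<lambda>T. T @ [t])) T"
    if "T \<in> fib_tilings m" for T
    using that by (simp add: tiling_rank_snoc fib_tilings_def c_def)
  ultimately have "bij_betw (tiling_rank \<circ> (\<lambda>T. T @ [t])) (fib_tilings m) {c t..<c t + k}"
    using bij_betw_cong by blast
  moreover have "bij_betw (\<lambda>T. T @ [t]) (fib_tilings m) ((\<lambda>T. T @ [t]) ` fib_tilings m)"
    by (simp add: bij_betw_def inj_on_def)
  ultimately show ?thesis
    by (simp add: bij_betw_comp_iff)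
qed

lemma bij_betw_tiling_rank: "bij_betw tiling_rank (fib_tilings m) {..<fib m}"
proof (induction m rule: fib.induct)
  case 1
  show ?case by (simp add: fib_tilings_0 bij_betw_def)
next
  case 2
  show ?case by (simp add: fib_tilings_1 tiling_rank_eq_sum bij_betw_def lessThan_Suc)
next
  case (3 m)
  have "bij_betw tiling_rank ((\<lambda>T. T @ [1]) ` fib_tilings (Suc m)) {..<fib (Suc m)}"
    using bij_betw_tiling_rank_snoc[OF 3(1), of 1] by (simp add: lessThan_atLeast0)
  moreover have "bij_betw tiling_rank ((\<lambda>T. T @ [2]) ` fib_tilings m)
      {fib (Suc m)..<fib (Suc (Suc m))}"
    using bij_betw_tiling_rank_snoc[OF 3(2), of 2] by (simp add: add.commute)
  moreover have "{..<fib (Suc m)} \<union> {fib (Suc m)..<fib (Suc (Suc m))} = {..<fib (Suc (Suc m))}"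
    by auto
  ultimately show ?case
    unfolding fib_tilings_Suc_Suc using bij_betw_combine by fastforce
qed

corollary sum_q_var_power_tiling_rank:
  "(\<Sum>T\<in>fib_tilings m. q_var ^ tiling_rank T) = q_int (int (fib m))"
  unfolding q_int_of_nat by (rule sum.reindex_bij_betw[OF bij_betw_tiling_rank])

lemma tiling_of_append:
  assumes "s \<in> {1..length P}"
  shows "tiling_of (P @ Q) s = tiling_of P s"
  using assms by (auto simp: tiling_of_def nth_append)

lemma tiling_of_snoc: "tiling_of (P @ [p]) (Suc (length P)) = snd p"
  by (simp add: tiling_of_def)

lemma uncancelled_append:
  assumes "s \<in> {1..length P}"
  shows "uncancelled b (P @ Q) s = uncancelled b P s"
  using assms by (auto simp: uncancelled_def column_of_def nth_append)

lemma uncancelled_snoc: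
  "uncancelled b (P @ [p]) (Suc (length P)) = b (fst p - Suc (length P) + 1)"
  by (simp add: uncancelled_def column_of_def)

lemma placements_0: "placements n b 0 = {[]}"
  by (auto simp: placements_def)

lemma placements_snoc_iff:
  "P @ [(i, T)] \<in> placements n b (Suc k) \<longleftrightarrow>
     i \<in> {1..n} \<and> P \<in> placements (i - 1) b k \<and> T \<in> fib_tilings (b (i - Suc k + 1))"
proof (cases "length P = k")
  case True
  have "{1..Suc k} = insert (Suc k) {1..k}"
    by auto
  then have "(\<forall>s\<in>{1..Suc k}. tiling_of (P @ [(i, T)]) s \<in> fib_tilings (uncancelled b (P @ [(i, T)]) s))
      \<longleftrightarrow> T \<in> fib_tilings (b (i - Suc k + 1)) \<and>
        (\<forall>s\<in>{1..k}. tiling_of P s \<in> fib_tilings (uncancelled b P s))"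
    using True
    by (auto simp: tiling_of_append uncancelled_append tiling_of_snoc uncancelled_snoc)
  moreover have "sorted_wrt (<) (map fst (P @ [(i, T)])) \<and> set (map fst (P @ [(i, T)])) \<subseteq> {1..n}
      \<longleftrightarrow> i \<in> {1..n} \<and> sorted_wrt (<) (map fst P) \<and> set (map fst P) \<subseteq> {1..i - 1}"
    by (force simp: sorted_wrt_append)
  ultimately show ?thesis
    using True unfolding placements_def by auto
qed (simp add: placements_def)

lemma placements_Suc_Suc:
  "placements (Suc n) b (Suc k) = placements n b (Suc k) \<union>
     (\<lambda>(P, T). P @ [(Suc n, T)]) ` (placements n b k \<times> fib_tilings (b (n - k + 1)))"
    (is "?L = ?R")
proof (intro set_eqI)
  fix Q :: "(nat \<times> nat list) list"
  show "Q \<in> ?L \<longleftrightarrow> Q \<in> ?R"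
  proof (cases Q rule: rev_exhaust)
    case Nil
    then show ?thesis by (auto simp: placements_def)
  next
    case (snoc P p)
    obtain i T where p: "p = (i, T)"
      by fastforce
    have image: "Q \<in> (\<lambda>(P, T). P @ [(Suc n, T)]) ` (placements n b k \<times> fib_tilings (b (n - k + 1)))
        \<longleftrightarrow> i = Suc n \<and> P \<in> placements n b k \<and> T \<in> fib_tilings (b (n - k + 1))"
      using snoc p by force
    show ?thesis
      unfolding Un_iff image unfolding snoc p placements_snoc_iff by (cases "i = Suc n") auto
  qed
qed

lemma placements_imp_le:
  assumes "P \<in> placements n b k"
  shows "k \<le> n"
proof -
  have "k = card (set (map fst P))" "set (map fst P) \<subseteq> {1..n}"
    using assms by (auto simp: placements_def strict_sorted_iff distinct_card simp flip: set_map)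
  then show ?thesis
    using card_mono[of "{1..n}" "set (map fst P)"] by simp
qed

lemma sum_placements_Suc_Suc:
  fixes g :: "(nat \<times> nat list) list \<Rightarrow> 'a::comm_monoid_add"
  shows "(\<Sum>P\<in>placements (Suc n) b (Suc k). g P) = (\<Sum>P\<in>placements n b (Suc k). g P) +
    (\<Sum>P\<in>placements n b k. \<Sum>T\<in>fib_tilings (b (n - k + 1)). g (P @ [(Suc n, T)]))"
proof -
  let ?C = "placements n b k \<times> fib_tilings (b (n - k + 1))"
  let ?f = "\<lambda>(P, T). P @ [(Suc n, T)]"
  have disjoint: "placements n b (Suc k) \<inter> ?f ` ?C = {}"
    by (auto simp: placements_def)
  have inj: "inj_on ?f ?C"
    by (auto simp: inj_on_def)
  have "(\<Sum>P\<in>placements (Suc n) b (Suc k). g P) =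
      (\<Sum>P\<in>placements n b (Suc k). g P) + (\<Sum>P\<in>?f ` ?C. g P)"
    unfolding placements_Suc_Suc using disjoint
    by (intro sum.union_disjoint) (auto simp: finite_placements finite_fib_tilings)
  also have "(\<Sum>P\<in>?f ` ?C. g P) = (\<Sum>(P, T)\<in>?C. g (P @ [(Suc n, T)]))"
    unfolding sum.reindex[OF inj] by (simp add: case_prod_unfold)
  finally show ?thesis
    by (simp add: sum.cartesian_product)
qed

lemma placement_weight_Suc:
  assumes "length P \<le> n"
  shows "placement_weight (Suc n) b P =
    q_var ^ fib (b (Suc n - length P)) * placement_weight n b P"
  using assms by (simp add: placement_weight_def Suc_diff_le power_add)

lemma placement_weight_snoc:
  "placement_weight (Suc n) b (P @ [(i, T)]) = q_var ^ tiling_rank T * placement_weight n b P"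
  by (simp add: placement_weight_def tiling_of_append tiling_of_snoc power_add)

lemma sum_placement_weight_Suc:
  "(\<Sum>P\<in>placements n b k. placement_weight (Suc n) b P) =
     q_var ^ fib (b (Suc n - k)) * RT n b k"
  unfolding RT_def sum_distrib_left
proof (intro sum.cong)
  fix P assume P: "P \<in> placements n b k"
  then have "length P = k"
    by (simp add: placements_def)
  then show "placement_weight (Suc n) b P =
      q_var ^ fib (b (Suc n - k)) * placement_weight n b P"
    using placements_imp_le[OF P] by (simp add: placement_weight_Suc)
qed simp

lemma RT_0_0: "RT 0 b 0 = 1"
  by (simp add: RT_def placements_0 placement_weight_def)

lemma RT_eq_0: "n < k \<Longrightarrow> RT n b k = 0"
  unfolding RT_def by (rule sum.neutral) (use placements_imp_le in fastforce)

lemma RT_Suc_0: "RT (Suc n) b 0 = q_var ^ fib (b (Suc n)) * RT n b 0"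
  using sum_placement_weight_Suc[of n b 0] by (simp add: RT_def[of "Suc n"] placements_0)

text \<open>
  For \<open>k \<ge> n\<close> the junk value \<open>b 0\<close> enters, but only with the coefficient \<open>RT n b (Suc k) = 0\<close>; for
  \<open>k > n\<close> also \<open>RT n b k = 0\<close>.
\<close>

lemma RT_Suc_Suc:
  "RT (Suc n) b (Suc k) =
     q_var ^ fib (b (n - k)) * RT n b (Suc k) + q_int (int (fib (b (n - k + 1)))) * RT n b k"
proof -
  have "RT (Suc n) b (Suc k) = q_var ^ fib (b (n - k)) * RT n b (Suc k) +
      (\<Sum>P\<in>placements n b k. \<Sum>T\<in>fib_tilings (b (n - k + 1)).
        q_var ^ tiling_rank T * placement_weight n b P)"
    by (simp add: RT_def[of "Suc n"] sum_placements_Suc_Suc sum_placement_weight_Suc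
        placement_weight_snoc)
  also have "(\<Sum>P\<in>placements n b k. \<Sum>T\<in>fib_tilings (b (n - k + 1)).
        q_var ^ tiling_rank T * placement_weight n b P) =
      q_int (int (fib (b (n - k + 1)))) * RT n b k"
    unfolding RT_def sum_distrib_left
    by (simp only: sum_distrib_right[symmetric] sum_q_var_power_tiling_rank)
  finally show ?thesis .
qed

theorem theorem9:
  fixes n :: nat and b :: "nat \<Rightarrow> nat" and x :: int
  assumes "n \<ge> 1"
    and "ferrers_board n b"
    and "b n > 0"
    and "x \<ge> int (b n)"
  shows "q_int x ^ n =
    (\<Sum>k=0..n. RT n b (n - k) * (\<Prod>i=1..k. q_int (x - int (fib (b i)))))"
proof -
  let ?F = "\<lambda>k. fib (b (Suc k))"
  have "q_int x ^ n = (\<Sum>k\<le>n. RT n b (n - k) * (\<Prod>i<k. q_int (x - int (?F i))))"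
  proof (rule power_eq_sum_prod_of_recurrence[where c = "\<lambda>k. q_int (int (?F k))"
      and d = "\<lambda>k. q_var ^ ?F k"])
    show "q_int x = q_int (int (?F k)) + q_var ^ ?F k * q_int (x - int (?F k))" for k
      using q_int_add[of "int (?F k)" "x - int (?F k)"] by simp
    show "RT (Suc m) b (Suc m - 0) = q_int (int (?F 0)) * RT m b (m - 0)" for m
      by (simp add: RT_Suc_Suc RT_eq_0)
    show "RT (Suc m) b (Suc m - Suc k) =
        q_var ^ ?F k * RT m b (m - k) + q_int (int (?F (Suc k))) * RT m b (m - Suc k)"
      if "k < m" for m k
      using that RT_Suc_Suc[of m b "m - Suc k"] by (simp add: Suc_diff_Suc)
  qed (simp_all add: RT_0_0 RT_Suc_0)
  then show ?thesis
    by (simp add: atLeast0AtMost prod.atLeast1_atMost_eq)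
qed

end
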